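(* Let $\mathbf c=\{c_1<\dots<c_r\}$ be the colors and $\mathbf d=\{d_1<\dots<d_s\}$ the dolors of the bicolored bosonic model, and let $t,z,w\in\mathbb C$. Then the (fused) weights satisfy the Yang–Baxter equation: for all $\alpha,\beta,\delta,\rho\in\mathbf c\cup\mathbf d$ and all $\gamma,\theta\in\mathbb N^{rs}$, $$\sum_{x,y,\kappa}\mathcal R_{z,w}(\alpha,\beta;x,y)\;T_z(x,\gamma;\delta,\kappa)\;T_w(y,\kappa;\rho,\theta)\;=\;\sum_{x,y,\kappa}T_w(\alpha,\gamma;x,\kappa)\;T_z(\beta,\kappa;y,\theta)\;\mathcal R_{z,w}(x,y;\delta,\rho),$$ where both sums run over $x,y\in\mathbf c\cup\mathbf d$ and $\kappa\in\mathbb N^{rs}$ (only finitely many terms are nonzero).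
   Context: $T_z(\text{left},\text{top};\text{right},\text{bottom})$ is the weight of a fused vertex with parameter $z$, defined as follows. Unfused vertices. An unfused vertex carries a color-dolor label $(c,d)$ and a parameter $z$. Its left and right (horizontal) edges each carry exactly one element of $\mathbf c\cup\mathbf d$; its top and bottom edges each carry a number in $\mathbb N=\{0,1,2,\dots\}$. The admissible configurations and weights are: (1) left $=$ right $=x$ a dolor, top $=$ bottom $=n$: weight $1$ if $x=d$; if $x\ne d$, weight $z^{\epsilon}t^{\eta}$ with $\epsilon=1$ if $c=c_1$, else $0$, and $\eta=n$ if $x<d$, else $0$. (2) left $=$ right $=a$ a color, top $=$ bottom $=n$: weight $z$ if $a=c$; $t^n$ if $c>a$; $1$ if $c<a$. (3) left $=d$, right $=c$, top $=n\ge1$, bottom $=n-1$: weight $1+t+\dots+t^{n-1}$ $(=(1-t^n)/(1-t))$. (4) left $=c$, right $=d$, top $=n$, bottom $=n+1$: weight $(1-t)z$. All other configurations have weight $0$. Fused vertices. Order color-dolor pairs by: $(c,d)<(c',d')$ iff $d>d'$, or $d=d'$ and $c<c'$. A fused vertex with parameter $z$ is a horizontal row of $rs$ unfused vertices with parameter $z$, one for each pair $(c,d)\in\mathbf c\times\mathbf d$, placed left to right in increasing order. Its top and bottom edges carry elements of $\mathbb N^{rs}$ (a multiplicity for each pair), its left and right edges carry elements of $\mathbf c\cup\mathbf d$. Its weight is the product of the unfused weights for the unique admissible labelling of the internal horizontal edges if one exists, and $0$ otherwise. $R$-vertices. $\mathcal R_{z,w}(a,b;a',b')$ is the weight of the $R$-vertex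 with upper-left edge $a$, lower-left edge $b$, upper-right edge $a'$, lower-right edge $b'$, all in $\mathbf c\cup\mathbf d$. Use the total order $c_1<\dots<c_r<d_1<\dots<d_s$. The nonzero weights are: $\mathcal R_{z,w}(a,a;a,a)=z-tw$; for $a\ne b$: $\mathcal R_{z,w}(a,b;a,b)=(1-t)z$ if $a>b$, and $(1-t)w$ if $a<b$; for $a\neq b$: $\mathcal R_{z,w}(a,b;b,a)=z-w$ if ($a,b$ are both dolors and $a>b$) or ($a,b$ are both colors and $a<b$) or ($a$ is a dolor and $b$ is a color), and $\mathcal R_{z,w}(a,b;b,a)=t(z-w)$ in the remaining cases (both dolors with $a<b$; both colors with $a>b$; $a$ a color and $b$ a dolor). All other $R$-weights are $0$. *)

theory Defs
  imports Complex_Main "HOL-Library.Groups_Big_Fun"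
begin

text \<open>
  The colors \<open>c\<^sub>1 < \<dots> < c\<^sub>r\<close> and the dolors \<open>d\<^sub>1 < \<dots> < d\<^sub>s\<close> are the elements of two arbitrary
  finite linearly ordered types \<open>'c\<close> and \<open>'d\<close>, so \<open>r = CARD('c)\<close>, \<open>s = CARD('d)\<close> and
  \<open>c\<^sub>1 = Min UNIV\<close>.  The disjoint union of colors and dolors is the sum type.
\<close>

abbreviation Color :: "'c \<Rightarrow> 'c + 'd" where "Color \<equiv> Inl"
abbreviation Dolor :: "'d \<Rightarrow> 'c + 'd" where "Dolor \<equiv> Inr"

text \<open>
  The edge arguments of a vertex are, in this order, left \<open>l\<close>, top \<open>n\<close>, right \<open>r\<close> and bottom \<open>m\<close>.
  Admissibility is kept separate from the weight: the weight of an admissible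
  configuration may vanish for special values of the parameters.
\<close>

definition unfused_admissible ::
  "'c \<times> 'd \<Rightarrow> 'c + 'd \<Rightarrow> nat \<Rightarrow> 'c + 'd \<Rightarrow> nat \<Rightarrow> bool" where
  "unfused_admissible p l n r m \<longleftrightarrow>
     (l = r \<and> n = m) \<or>
     (l = Dolor (snd p) \<and> r = Color (fst p) \<and> n \<ge> 1 \<and> m = n - 1) \<or>
     (l = Color (fst p) \<and> r = Dolor (snd p) \<and> m = n + 1)"

definition unfused_weight ::
  "complex \<Rightarrow> complex \<Rightarrow> 'c::{finite,linorder} \<times> 'd::{finite,linorder} \<Rightarrow>
   'c + 'd \<Rightarrow> nat \<Rightarrow> 'c + 'd \<Rightarrow> nat \<Rightarrow> complex" where
  "unfused_weight t z p l n r m =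
     (let c = fst p; d = snd p in
      if l = r \<and> n = m then
        (case l of
           Dolor x \<Rightarrow>
             if x = d then 1
             else z ^ (if c = Min UNIV then 1 else 0) * t ^ (if x < d then n else 0)
         | Color a \<Rightarrow>
             if a = c then z else if c > a then t ^ n else 1)
      else if l = Dolor d \<and> r = Color c \<and> n \<ge> 1 \<and> m = n - 1 then
        (\<Sum>i<n. t ^ i)
      else if l = Color c \<and> r = Dolor d \<and> m = n + 1 then
        (1 - t) * z
      else 0)"

definition pair_less :: "'c::linorder \<times> 'd::linorder \<Rightarrow> 'c \<times> 'd \<Rightarrow> bool" where
  "pair_less p q \<longleftrightarrow> snd p > snd q \<or> (snd p = snd q \<and> fst p < fst q)"

definition pairs :: "('c::{finite,linorder} \<times> 'd::{finite,linorder}) list" where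
  "pairs = [(c, d). d \<leftarrow> rev (sorted_list_of_set UNIV), c \<leftarrow> sorted_list_of_set UNIV]"

lemma set_pairs: "set pairs = UNIV"
  by (auto simp: pairs_def)

lemma sorted_pairs: "sorted_wrt pair_less pairs"
proof -
  have "sorted_wrt pair_less [(c, d). d \<leftarrow> ds, c \<leftarrow> cs]"
    if "sorted_wrt (>) ds" and "sorted_wrt (<) cs" for ds :: "'b list" and cs :: "'a list"
    using that
  proof (induction ds)
    case (Cons d ds)
    then show ?case
      by (auto simp: sorted_wrt_append sorted_wrt_map pair_less_def)
  qed simp
  then show ?thesis
    by (simp add: pairs_def sorted_wrt_rev)
qed

text \<open>
  A labelling of the horizontal edges of a fused vertex is the list \<open>h\<close> of all \<open>rs + 1\<close> of them
  from left to right; the \<open>i\<close>-th unfused vertex sits between \<open>h ! i\<close> and \<open>h ! Suc i\<close>.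
\<close>

definition fused_labelling ::
  "'c::{finite,linorder} + 'd::{finite,linorder} \<Rightarrow> ('c \<times> 'd \<Rightarrow> nat) \<Rightarrow>
   'c + 'd \<Rightarrow> ('c \<times> 'd \<Rightarrow> nat) \<Rightarrow> ('c + 'd) list \<Rightarrow> bool" where
  "fused_labelling l N r M h \<longleftrightarrow>
     length h = length (pairs :: ('c \<times> 'd) list) + 1 \<and> hd h = l \<and> last h = r \<and>
     (\<forall>i < length (pairs :: ('c \<times> 'd) list).
        unfused_admissible (pairs ! i) (h ! i) (N (pairs ! i)) (h ! Suc i) (M (pairs ! i)))"

lemma unfused_admissible_unique:
  "unfused_admissible p l n x m \<Longrightarrow> unfused_admissible p l n y m \<Longrightarrow> x = y"
  by (auto simp: unfused_admissible_def)

lemma fused_labelling_unique: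
  fixes l r :: "'a::{finite,linorder} + 'b::{finite,linorder}"
  assumes "fused_labelling l N r M h" and "fused_labelling l N r M h'"
  shows "h = h'"
proof (rule nth_equalityI)
  show "length h = length h'"
    using assms by (simp add: fused_labelling_def)
  show "h ! i = h' ! i" if "i < length h" for i
    using that
  proof (induction i)
    case 0
    have "h \<noteq> []" "h' \<noteq> []"
      using assms by (auto simp: fused_labelling_def)
    moreover have "hd h = hd h'"
      using assms by (simp add: fused_labelling_def)
    ultimately show ?case
      by (simp add: hd_conv_nth)
  next
    case (Suc i)
    let ?p = "pairs ! i"
    have "i < length (pairs :: ('a \<times> 'b) list)"
      using assms(1) Suc.prems by (simp add: fused_labelling_def)
    then have "unfused_admissible ?p (h ! i) (N ?p) (h ! Suc i) (M ?p)"
      and "unfused_admissible ?p (h' ! i) (N ?p) (h' ! Suc i) (M ?p)"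
      using assms by (simp_all add: fused_labelling_def)
    moreover have "h ! i = h' ! i"
      using Suc by simp
    ultimately show ?case
      using unfused_admissible_unique by metis
  qed
qed

definition fused_weight ::
  "complex \<Rightarrow> complex \<Rightarrow> 'c::{finite,linorder} + 'd::{finite,linorder} \<Rightarrow> ('c \<times> 'd \<Rightarrow> nat) \<Rightarrow>
   'c + 'd \<Rightarrow> ('c \<times> 'd \<Rightarrow> nat) \<Rightarrow> complex" where
  "fused_weight t z l N r M =
     (if \<exists>!h. fused_labelling l N r M h then
        let h = (THE h. fused_labelling l N r M h) in
        \<Prod>i < length (pairs :: ('c \<times> 'd) list).
          unfused_weight t z (pairs ! i)
            (h ! i) (N (pairs ! i)) (h ! Suc i) (M (pairs ! i))
      else 0)"

text \<open>The total order \<open>c\<^sub>1 < \<dots> < c\<^sub>r < d\<^sub>1 < \<dots> < d\<^sub>s\<close>:\<close>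

fun edge_less :: "'c::linorder + 'd::linorder \<Rightarrow> 'c + 'd \<Rightarrow> bool" where
  "edge_less (Color a) (Color b) \<longleftrightarrow> a < b"
| "edge_less (Color a) (Dolor b) \<longleftrightarrow> True"
| "edge_less (Dolor a) (Color b) \<longleftrightarrow> False"
| "edge_less (Dolor a) (Dolor b) \<longleftrightarrow> a < b"

text \<open>
  The edge arguments of an \<open>R\<close>-vertex are upper left, lower left, upper right, lower right.
\<close>

definition R_weight ::
  "complex \<Rightarrow> complex \<Rightarrow> complex \<Rightarrow>
   'c::linorder + 'd::linorder \<Rightarrow> 'c + 'd \<Rightarrow> 'c + 'd \<Rightarrow> 'c + 'd \<Rightarrow> complex" where
  "R_weight t z w a b a' b' =
     (if a = b then
        (if a' = a \<and> b' = a then z - t * w else 0)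
      else if a' = a \<and> b' = b then
        (if edge_less b a then (1 - t) * z else (1 - t) * w)
      else if a' = b \<and> b' = a then
        (case (a, b) of
           (Dolor x, Dolor y) \<Rightarrow> if x > y then z - w else t * (z - w)
         | (Color x, Color y) \<Rightarrow> if x < y then z - w else t * (z - w)
         | (Dolor x, Color y) \<Rightarrow> z - w
         | (Color x, Dolor y) \<Rightarrow> t * (z - w))
      else 0)"

end

theory Submission
  imports Defs "HOL-Library.FuncSet"
begin

text \<open>
  The train argument is run one unfused vertex at a time, with an $R$-matrix that changes along the
  row.  Only the weights $(1-t)z$ and $(1-t)w$ depend on the order of the labels, and passing the vertex
  of the pair $(c,d)$ changes that order: if $c$ is minimal and $d$ maximal, then $c$ is moved
  to the position just below $d$.  This would fail because of the factor $z$ that a dolor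
  $x \<noteq> d$ picks up at $c_1$; but $x$ keeps its label through all vertices $(c_1,d),\dots,(c_r,d)$, so
  the factor may be collected at the end of this block, where it moves the dolors other than $d$
  from the bottom to the top of the order.  The effect of a whole
  block is then a rotation of the dolors, and after all $s$ blocks the original order is restored.
\<close>

section \<open>Matrices\<close>

definition mat_mul :: "('i::finite \<Rightarrow> 'i \<Rightarrow> complex) \<Rightarrow> ('i \<Rightarrow> 'i \<Rightarrow> complex) \<Rightarrow> 'i \<Rightarrow> 'i \<Rightarrow> complex" where
  "mat_mul A B i j = (\<Sum>k\<in>UNIV. A i k * B k j)"

lemma mat_mul_assoc: "mat_mul (mat_mul A B) C = mat_mul A (mat_mul B C)"
proof (intro ext)
  fix i j
  have "mat_mul (mat_mul A B) C i j = (\<Sum>k\<in>UNIV. \<Sum>l\<in>UNIV. A i l * B l k * C k j)"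
    by (simp add: mat_mul_def sum_distrib_right)
  also have "\<dots> = (\<Sum>l\<in>UNIV. \<Sum>k\<in>UNIV. A i l * B l k * C k j)"
    by (rule sum.swap)
  also have "\<dots> = mat_mul A (mat_mul B C) i j"
    by (simp add: mat_mul_def sum_distrib_left mult.assoc)
  finally show "mat_mul (mat_mul A B) C i j = mat_mul A (mat_mul B C) i j" .
qed

definition mat_diag :: "('i::finite \<Rightarrow> complex) \<Rightarrow> 'i \<Rightarrow> 'i \<Rightarrow> complex" where
  "mat_diag g i j = (if i = j then g i else 0)"

lemma mat_mul_diag_left: "mat_mul (mat_diag g) A i j = g i * A i j"
  by (simp add: mat_mul_def mat_diag_def if_distrib[of "\<lambda>x. x * _"] cong: if_cong)

lemma mat_mul_diag_right: "mat_mul A (mat_diag g) i j = A i j * g j"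
  by (simp add: mat_mul_def mat_diag_def if_distrib[of "\<lambda>x. _ * x"] cong: if_cong)

lemma mat_mul_one [simp]:
  "mat_mul (mat_diag (\<lambda>_. 1)) A = A" "mat_mul A (mat_diag (\<lambda>_. 1)) = A"
  by (simp_all add: fun_eq_iff mat_mul_diag_left mat_mul_diag_right)

definition mat_prod :: "('p \<Rightarrow> 'i::finite \<Rightarrow> 'i \<Rightarrow> complex) \<Rightarrow> 'p list \<Rightarrow> 'i \<Rightarrow> 'i \<Rightarrow> complex" where
  "mat_prod f ps = foldr (\<lambda>p. mat_mul (f p)) ps (mat_diag (\<lambda>_. 1))"

lemma mat_prod_simps [simp]:
  "mat_prod f [] = mat_diag (\<lambda>_. 1)"
  "mat_prod f (p # ps) = mat_mul (f p) (mat_prod f ps)"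
  by (simp_all add: mat_prod_def)

lemma mat_prod_append: "mat_prod f (ps @ qs) = mat_mul (mat_prod f ps) (mat_prod f qs)"
  by (induction ps) (simp_all add: mat_mul_assoc)

lemma mat_prod_commute:
  assumes "\<And>p. p \<in> set ps \<Longrightarrow> mat_mul G (f p) = mat_mul (f p) G"
  shows "mat_mul G (mat_prod f ps) = mat_mul (mat_prod f ps) G"
  using assms
proof (induction ps)
  case (Cons p ps)
  then have "mat_mul G (f p) = mat_mul (f p) G" "mat_mul G (mat_prod f ps) = mat_mul (mat_prod f ps) G"
    by simp_all
  then show ?case
    unfolding mat_prod_simps by (metis mat_mul_assoc)
qed simp

lemma mat_prod_cong: "(\<And>p. p \<in> set ps \<Longrightarrow> f p = g p) \<Longrightarrow> mat_prod f ps = mat_prod g ps"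
  by (induction ps) simp_all

text \<open>The train argument in abstract form: \<open>R\<close> is pushed through one factor after
  the other and may become a different matrix each time.\<close>

lemma intertwine_mul:
  assumes "mat_mul R U = mat_mul U' R'" and "mat_mul R' V = mat_mul V' R''"
  shows "mat_mul R (mat_mul U V) = mat_mul (mat_mul U' V') R''"
  by (metis assms mat_mul_assoc)

section \<open>A single column\<close>

definition q_number :: "complex \<Rightarrow> nat \<Rightarrow> complex" where
  "q_number t n = (\<Sum>i<n. t ^ i)"

lemma q_number_simps [simp]:
  "q_number t 0 = 0" "q_number t (Suc n) = q_number t n + t ^ n"
  by (simp_all add: q_number_def)

text \<open>Eliminating \<open>t ^ n\<close> in favour of \<open>q_number t n\<close>, rather than
  the reverse, avoids dividing by 1 - t, so t = 1 needs no separate treatment.\<close>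

lemma power_q_number: "t ^ n = 1 - (1 - t) * q_number t n"
  by (simp add: q_number_def one_diff_power_eq[symmetric])

definition column_weight ::
  "complex \<Rightarrow> 'e \<Rightarrow> 'e \<Rightarrow> ('e \<Rightarrow> complex) \<Rightarrow> complex \<Rightarrow> 'e \<Rightarrow> nat \<Rightarrow> 'e \<Rightarrow> nat \<Rightarrow> complex" where
  "column_weight t c d u z l n r m =
     (if l = r then
        if n = m then (if l = c then z else if l = d then 1 else u l ^ n) else 0
      else if l = d \<and> r = c \<and> n = Suc m then q_number t n
      else if l = c \<and> r = d \<and> m = Suc n then (1 - t) * z
      else 0)"

text \<open>The swap factors \<open>s\<close> and the order \<open>lt\<close> are independent
  arguments, because only the order changes along the row.\<close>

definition order_R ::
  "complex \<Rightarrow> ('e \<Rightarrow> 'e \<Rightarrow> complex) \<Rightarrow> ('e \<Rightarrow> 'e \<Rightarrow> bool) \<Rightarrow> complex \<Rightarrow> complex \<Rightarrow>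
   'e \<times> 'e \<Rightarrow> 'e \<times> 'e \<Rightarrow> complex" where
  "order_R t s lt z w = (\<lambda>(a, b) (a', b').
     if a = b then (if a' = a \<and> b' = a then z - t * w else 0)
     else if a' = a \<and> b' = b then (1 - t) * (if lt b a then z else w)
     else if a' = b \<and> b' = a then s a b * (z - w)
     else 0)"

text \<open>Matrix indices are pairs (upper label, lower label). The bound \<open>Suc n\<close> on
  the middle edge loses nothing for the vertices considered, as each of them raises the multiplicity
  by at most one.\<close>

definition two_rows :: "('e \<Rightarrow> nat \<Rightarrow> 'e \<Rightarrow> nat \<Rightarrow> complex) \<Rightarrow> ('e \<Rightarrow> nat \<Rightarrow> 'e \<Rightarrow> nat \<Rightarrow> complex) \<Rightarrow>
    nat \<Rightarrow> nat \<Rightarrow> 'e \<times> 'e \<Rightarrow> 'e \<times> 'e \<Rightarrow> complex" where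
  "two_rows T T' n m = (\<lambda>(x, y) (x', y'). \<Sum>k\<le>Suc n. T x n x' k * T' y k y' m)"

lemma two_rows_column:
  assumes "c \<noteq> d"
  shows "two_rows (column_weight t c d u z) T n m (x, y) (x', y') =
    (if x = x' then (if x = c then z else if x = d then 1 else u x ^ n) * T y n y' m
     else if x = d \<and> x' = c then q_number t n * T y (n - 1) y' m
     else if x = c \<and> x' = d then (1 - t) * z * T y (Suc n) y' m
     else 0)"
proof -
  \<comment> \<open>The upper vertex changes \<open>n\<close> by at most one. For
    \<open>n = 0\<close> the truncated \<open>n - 1\<close> is harmless, since
    \<open>q_number t 0 = 0\<close>.\<close>
  have "(\<Sum>k\<le>Suc n. column_weight t c d u z x n x' k * T y k y' m) =
    (\<Sum>k\<in>{n - 1, n, Suc n}. column_weight t c d u z x n x' k * T y k y' m)"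
    by (rule sum.mono_neutral_right) (auto simp: column_weight_def)
  then show ?thesis
    using assms by (cases n) (auto simp: two_rows_def column_weight_def)
qed

lemma mat_mul_order_R_left:
  fixes A :: "('e::finite) \<times> 'e \<Rightarrow> 'e \<times> 'e \<Rightarrow> complex"
  shows "mat_mul (order_R t s lt z w) A (a, b) j =
    (if a = b then (z - t * w) * A (a, a) j
     else (1 - t) * (if lt b a then z else w) * A (a, b) j + s a b * (z - w) * A (b, a) j)"
proof -
  have "mat_mul (order_R t s lt z w) A (a, b) j =
    (\<Sum>k\<in>{(a, b), (b, a)}. order_R t s lt z w (a, b) k * A k j)"
    unfolding mat_mul_def
    by (rule sum.mono_neutral_right) (auto simp: order_R_def split: if_splits)
  then show ?thesis
    by (auto simp: order_R_def)
qed

lemma mat_mul_order_R_right: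
  fixes A :: "('e::finite) \<times> 'e \<Rightarrow> 'e \<times> 'e \<Rightarrow> complex"
  shows "mat_mul A (order_R t s lt z w) i (a, b) =
    (if a = b then (z - t * w) * A i (a, a)
     else (1 - t) * (if lt b a then z else w) * A i (a, b) + s b a * (z - w) * A i (b, a))"
proof -
  have "mat_mul A (order_R t s lt z w) i (a, b) =
    (\<Sum>k\<in>{(a, b), (b, a)}. A i k * order_R t s lt z w k (a, b))"
    unfolding mat_mul_def
    by (rule sum.mono_neutral_right) (auto simp: order_R_def split: if_splits)
  then show ?thesis
    by (auto simp: order_R_def)
qed

text \<open>
  The three possible tuples belong, in this order, to a color below $c$, a color above $c$ and a
  dolor above $d$; a dolor below $d$ has the first one again.
\<close>

definition column_data :: "complex \<Rightarrow> ('e \<Rightarrow> 'e \<Rightarrow> complex) \<Rightarrow> 'e \<Rightarrow> 'e \<Rightarrow> ('e \<Rightarrow> complex) \<Rightarrow> bool" where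
  "column_data t s c d u \<longleftrightarrow> c \<noteq> d \<and> s c d = t \<and> s d c = 1 \<and>
    (\<forall>a. a \<noteq> c \<longrightarrow> a \<noteq> d \<longrightarrow>
      (s c a, s a c, s a d, s d a, u a) \<in> {(t, 1, t, 1, t), (1, t, t, 1, 1), (t, 1, 1, t, 1)})"

lemma column_weight_simps:
  assumes "c \<noteq> d"
  shows "column_weight t c d u z c n c m = (if n = m then z else 0)"
    and "column_weight t c d u z d n d m = (if n = m then 1 else 0)"
    and "column_weight t c d u z d n c m = (if n = Suc m then q_number t n else 0)"
    and "column_weight t c d u z c n d m = (if m = Suc n then (1 - t) * z else 0)"
    and "a \<noteq> c \<Longrightarrow> a \<noteq> d \<Longrightarrow> column_weight t c d u z a n a m = (if n = m then u a ^ n else 0)"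
    and "a \<noteq> c \<Longrightarrow> a \<noteq> d \<Longrightarrow> b \<noteq> a \<Longrightarrow> column_weight t c d u z a n b m = 0"
    and "a \<noteq> c \<Longrightarrow> a \<noteq> d \<Longrightarrow> b \<noteq> a \<Longrightarrow> column_weight t c d u z b n a m = 0"
  using assms by (auto simp: column_weight_def)

lemma two_rows_column_simps:
  fixes t :: complex and u :: "'e \<Rightarrow> complex"
  assumes "c \<noteq> d"
  defines "U \<equiv> \<lambda>z T n m. two_rows (column_weight t c d u z) T n m"
  shows "U z T n m (c, y) (c, y') = z * T y n y' m"
    and "U z T n m (d, y) (d, y') = T y n y' m"
    and "U z T n m (d, y) (c, y') = q_number t n * T y (n - 1) y' m"
    and "U z T n m (c, y) (d, y') = (1 - t) * z * T y (Suc n) y' m"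
    and "a \<noteq> c \<Longrightarrow> a \<noteq> d \<Longrightarrow> U z T n m (a, y) (a, y') = u a ^ n * T y n y' m"
    and "a \<noteq> c \<Longrightarrow> a \<noteq> d \<Longrightarrow> b \<noteq> a \<Longrightarrow> U z T n m (a, y) (b, y') = 0"
    and "a \<noteq> c \<Longrightarrow> a \<noteq> d \<Longrightarrow> b \<noteq> a \<Longrightarrow> U z T n m (b, y) (a, y') = 0"
  using assms(1) by (auto simp: U_def two_rows_column)

lemma column_weight_conserves:
  "column_weight t c d u z l n r m \<noteq> 0 \<Longrightarrow> e \<noteq> c \<Longrightarrow> e \<noteq> d \<Longrightarrow> l = e \<longleftrightarrow> r = e"
  by (auto simp: column_weight_def split: if_splits)

text \<open>A label other than \<open>c\<close> and \<open>d\<close> passes straight through both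
  rows, so a nonzero entry has it equally often on the left and on the right. Multiplicities rather
  than positions are compared because the R-matrix may exchange the two labels.\<close>

lemma two_rows_column_eq_0:
  assumes "e \<noteq> c" "e \<noteq> d"
    "of_bool (e = x) + of_bool (e = y) \<noteq> (of_bool (e = x') + of_bool (e = y') :: nat)"
  shows "two_rows (column_weight t c d u z) (column_weight t c d u w) n m (x, y) (x', y') = 0"
proof -
  have "column_weight t c d u z x n x' k * column_weight t c d u w y k y' m = 0" for k
  proof (rule ccontr)
    assume "\<not> ?thesis"
    then have "x = e \<longleftrightarrow> x' = e" "y = e \<longleftrightarrow> y' = e"
      using column_weight_conserves[OF _ assms(1,2)] by (metis mult_zero_left, metis mult_zero_right)
    then have "(e = x) = (e = x')" "(e = y) = (e = y')" by auto
    with assms(3) show False by simp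
  qed
  then show ?thesis
    unfolding two_rows_def prod.case by (intro sum.neutral) blast
qed

lemma of_bool_add_eq_iff:
  "of_bool P + of_bool Q = (of_bool R + of_bool S :: nat) \<longleftrightarrow> (P \<or> Q \<longleftrightarrow> R \<or> S) \<and> (P \<and> Q \<longleftrightarrow> R \<and> S)"
  by (cases P; cases Q; cases R; cases S) simp_all

text \<open>Both sides preserve the multiplicity of each label other than \<open>c\<close> and
  \<open>d\<close>. An entry violating this vanishes on both sides; the others are checked according
  to whether none, one or both of the labels lie outside {c, d}. Moving \<open>c\<close> from the
  bottom to just below \<open>d\<close> alters only its comparison with a third label.\<close>

lemma column_intertwines:
  fixes c d :: "'e::finite"
  assumes data: "column_data t s c d u"
    and c_min: "\<And>a. a \<noteq> c \<Longrightarrow> lt c a \<and> \<not> lt a c"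
    and d_max: "\<And>a. a \<noteq> d \<Longrightarrow> lt a d \<and> \<not> lt d a \<and> lt' a d \<and> \<not> lt' d a"
    and c_moved: "\<And>a. a \<noteq> c \<Longrightarrow> a \<noteq> d \<Longrightarrow> lt' a c \<and> \<not> lt' c a"
    and rest: "\<And>a b. a \<noteq> c \<Longrightarrow> b \<noteq> c \<Longrightarrow> lt' a b = lt a b"
  shows "mat_mul (order_R t s lt z w) (two_rows (column_weight t c d u z) (column_weight t c d u w) n m) =
    mat_mul (two_rows (column_weight t c d u w) (column_weight t c d u z) n m) (order_R t s lt' z w)"
proof -
  have cd: "c \<noteq> d" "d \<noteq> c" "s c d = t" "s d c = 1"
    using data by (auto simp: column_data_def)
  have oth: "(s c a, s a c, s a d, s d a, u a) \<in> {(t, 1, t, 1, t), (1, t, t, 1, 1), (t, 1, 1, t, 1)}"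
    if "a \<noteq> c" "a \<noteq> d" for a
    using data that by (auto simp: column_data_def)
  have lts: "lt c d" "\<not> lt d c" "lt' c d" "\<not> lt' d c"
    using c_min d_max cd by auto
  note L = mat_mul_order_R_left mat_mul_order_R_right two_rows_column_simps[OF cd(1)]
    column_weight_simps[OF cd(1)] cd lts
  let ?T = "column_weight t c d u"
  let ?eq = "\<lambda>a b a' b'.
    mat_mul (order_R t s lt z w) (two_rows (?T z) (?T w) n m) (a, b) (a', b') =
    mat_mul (two_rows (?T w) (?T z) n m) (order_R t s lt' z w) (a, b) (a', b')"

  have zero: "?eq a b a' b'"
    if "e \<noteq> c" "e \<noteq> d" "of_bool (e = a) + of_bool (e = b) \<noteq> (of_bool (e = a') + of_bool (e = b') :: nat)"
    for a b a' b' e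
  proof -
    \<comment> \<open>The R-matrices preserve the unordered pair of labels, so no other entries of
      the two-row matrices occur on either side.\<close>
    have U: "two_rows (?T z) (?T w) n m (p, q) (p', q') = 0"
      if "(p, q) \<in> {(a, b), (b, a)}" "(p', q') \<in> {(a', b'), (b', a')}" for z w p q p' q'
      using that \<open>of_bool (e = a) + _ \<noteq> _\<close> by (intro two_rows_column_eq_0[OF \<open>e \<noteq> c\<close> \<open>e \<noteq> d\<close>]) auto
    then show ?thesis
      unfolding mat_mul_order_R_left mat_mul_order_R_right
      by (cases "a = b"; cases "a' = b'") (simp_all add: U)
  qed
  \<comment> \<open>Splitting \<open>n\<close> resolves the truncated \<open>n - 1\<close>; with
    powers of t eliminated, polynomial identities in t, z, w and q-numbers remain.\<close>
  have two: "?eq a b a' b'"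
    if "(a, b) \<in> {(c, c), (c, d), (d, c), (d, d)}" "(a', b') \<in> {(c, c), (c, d), (d, c), (d, d)}"
    for a b a' b'
    using that
    by (elim insertE emptyE; simp only: prod.inject; elim conjE; hypsubst; cases n;
        auto simp: L power_q_number algebra_simps)
  \<comment> \<open>The three tuples of \<open>column_data\<close> are tried in turn. This is where
    the difference between \<open>lt\<close> and \<open>lt'\<close> enters.\<close>
  have one: "?eq a b a' b'" if e: "e \<noteq> c" "e \<noteq> d"
    and "(a, b) \<in> {(c, e), (e, c), (d, e), (e, d)}" "(a', b') \<in> {(c, e), (e, c), (d, e), (e, d)}"
    for a b a' b' e
  proof -
    note o = e e[symmetric] c_min[OF e(1)] d_max[OF e(2)] c_moved[OF e]
    from oth[OF e] consider "s c e = t" "s e c = 1" "s e d = t" "s d e = 1" "u e = t"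
      | "s c e = 1" "s e c = t" "s e d = t" "s d e = 1" "u e = 1"
      | "s c e = t" "s e c = 1" "s e d = 1" "s d e = t" "u e = 1"
      by auto
    then show ?thesis
      using that(3,4)
      by cases ((elim insertE emptyE; simp only: prod.inject; elim conjE; hypsubst; cases n;
        auto simp: L o power_q_number algebra_simps)+)
  qed
  \<comment> \<open>Here the columns act by a scalar that is free of z and w and the same for (a, b)
    and (b, a), so it suffices that the two orders agree on these labels.\<close>
  have none: "?eq a b a' b'" if e: "a \<noteq> c" "a \<noteq> d" "b \<noteq> c" "b \<noteq> d" and "(a', b') \<in> {(a, b), (b, a)}"
    for a b a' b'
    using that(5)
    by (elim insertE emptyE; simp only: prod.inject; elim conjE; hypsubst; cases "a = b")
      (simp_all add: L e e[symmetric] rest)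
  show ?thesis
  proof (intro ext, clarify)
    fix a b a' b'
    show "?eq a b a' b'"
    proof (cases "\<exists>e. e \<noteq> c \<and> e \<noteq> d \<and>
        of_bool (e = a) + of_bool (e = b) \<noteq> (of_bool (e = a') + of_bool (e = b') :: nat)")
      case True
      then show ?thesis using zero by blast
    next
      case False
      then have count: "of_bool (e = a) + of_bool (e = b) = (of_bool (e = a') + of_bool (e = b') :: nat)"
        if "e \<noteq> c" "e \<noteq> d" for e
        using that by blast
      have F: "e = a \<or> e = b \<longleftrightarrow> e = a' \<or> e = b'" "e = a \<and> e = b \<longleftrightarrow> e = a' \<and> e = b'"
        if "e \<noteq> c" "e \<noteq> d" for e
        using of_bool_add_eq_iff[THEN iffD1, OF count[OF that]] by blast+
      consider "a \<in> {c, d}" "b \<in> {c, d}" | "a \<in> {c, d}" "b \<notin> {c, d}" | "a \<notin> {c, d}" "b \<in> {c, d}"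
        | "a \<notin> {c, d}" "b \<notin> {c, d}" by blast
      then show ?thesis
      proof cases
        case 1
        then have "a' \<in> {c, d}" "b' \<in> {c, d}"
          using F(1) by blast+
        with 1 show ?thesis
          by (intro two) auto
      next
        case 2
        then have "a' \<in> {c, d} \<and> b' = b \<or> a' = b \<and> b' \<in> {c, d}"
          using F(1)[of a'] F(1)[of b'] F[of b] by auto
        with 2 show ?thesis
          by (intro one[of b]) auto
      next
        case 3
        then have "a' \<in> {c, d} \<and> b' = a \<or> a' = a \<and> b' \<in> {c, d}"
          using F(1)[of a'] F(1)[of b'] F[of a] by auto
        with 3 show ?thesis
          by (intro one[of a]) auto
      next
        case 4
        then have "(a', b') \<in> {(a, b), (b, a)}"
          using F[of a] F[of b] by auto
        with 4 show ?thesis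
          by (intro none) auto
      qed
    qed
  qed
qed

section \<open>The intermediate $R$-matrices\<close>

definition swap_factor ::
  "complex \<Rightarrow> 'c::linorder + 'd::linorder \<Rightarrow> 'c + 'd \<Rightarrow> complex" where
  "swap_factor t a b =
     (case (a, b) of
        (Dolor x, Dolor y) \<Rightarrow> if x > y then 1 else t
      | (Color x, Color y) \<Rightarrow> if x < y then 1 else t
      | (Dolor x, Color y) \<Rightarrow> 1
      | (Color x, Dolor y) \<Rightarrow> t)"

lemma R_weight_eq_order_R:
  "R_weight t z w a b a' b' = order_R t (swap_factor t) edge_less z w (a, b) (a', b')"
proof -
  have "(if edge_less b a then (1 - t) * z else (1 - t) * w) = (1 - t) * (if edge_less b a then z else w)"
    by simp
  moreover have "(case (a, b) of
      (Dolor x, Dolor y) \<Rightarrow> if x > y then z - w else t * (z - w)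
    | (Color x, Color y) \<Rightarrow> if x < y then z - w else t * (z - w)
    | (Dolor x, Color y) \<Rightarrow> z - w
    | (Color x, Dolor y) \<Rightarrow> t * (z - w)) = swap_factor t a b * (z - w)"
    by (cases a; cases b) (simp_all add: swap_factor_def)
  ultimately show ?thesis
    unfolding R_weight_def order_R_def prod.case by (simp only:)
qed

definition passing_factor :: "complex \<Rightarrow> 'c::linorder \<times> 'd::linorder \<Rightarrow> 'c + 'd \<Rightarrow> complex" where
  "passing_factor t p a =
     (case a of Color a \<Rightarrow> if a < fst p then t else 1 | Dolor x \<Rightarrow> if x < snd p then t else 1)"

lemma column_data_swap_passing:
  "column_data t (swap_factor t) (Color c) (Dolor d) (passing_factor t (c, d))"
  by (auto simp: column_data_def swap_factor_def passing_factor_def not_less_iff_gr_or_eq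
      split: sum.split)

section \<open>Core weights and the gauge factor\<close>

abbreviation core_weight ::
  "complex \<Rightarrow> complex \<Rightarrow> 'c::{finite,linorder} \<times> 'd::{finite,linorder} \<Rightarrow>
   'c + 'd \<Rightarrow> nat \<Rightarrow> 'c + 'd \<Rightarrow> nat \<Rightarrow> complex" where
  "core_weight t z p \<equiv> column_weight t (Color (fst p)) (Dolor (snd p)) (passing_factor t p) z"

text \<open>
  The power of $z$ of the first vertex of a block is split off, as otherwise the intermediate
  $R$-weights would contain $z/w$ and $w/z$.
\<close>

definition gauge :: "'d \<Rightarrow> complex \<Rightarrow> 'c + 'd \<Rightarrow> complex" where
  "gauge d z a = (case a of Color _ \<Rightarrow> 1 | Dolor x \<Rightarrow> if x = d then 1 else z)"

text \<open>The extra factor z belongs to a dolor other than that of \<open>p\<close> going straight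
  through. The gauge is 1 on colors and on the dolor of \<open>p\<close>, so it can be read off at
  the right edge in every configuration.\<close>

lemma unfused_weight_eq_core:
  "unfused_weight t z p l n r m =
     core_weight t z p l n r m * (if fst p = Min UNIV then gauge (snd p) z r else 1)"
  by (auto simp: unfused_weight_def column_weight_def passing_factor_def gauge_def Let_def q_number_def split: sum.split)

text \<open>A label that changes at the vertex is the color or the dolor of \<open>p\<close>, before
  and after, and both have gauge 1.\<close>

lemma gauge_core_weight:
  "core_weight t z p l n r m \<noteq> 0 \<Longrightarrow> gauge (snd p) y l = gauge (snd p) y r"
  by (auto simp: column_weight_def gauge_def split: if_splits)

definition gauge_mat where
  "gauge_mat d z w = mat_diag (\<lambda>(x, y). gauge d z x * gauge d w y)"

definition column_mat where
  "column_mat t z w \<gamma> \<theta> p = two_rows (unfused_weight t z p) (unfused_weight t w p) (\<gamma> p) (\<theta> p)"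

definition core_mat where
  "core_mat t z w \<gamma> \<theta> p = two_rows (core_weight t z p) (core_weight t w p) (\<gamma> p) (\<theta> p)"

lemma column_mat_eq_core:
  "column_mat t z w \<gamma> \<theta> p =
     (if fst p = Min UNIV then mat_mul (core_mat t z w \<gamma> \<theta> p) (gauge_mat (snd p) z w)
      else core_mat t z w \<gamma> \<theta> p)"
  by (auto simp: fun_eq_iff column_mat_def core_mat_def gauge_mat_def mat_mul_diag_right two_rows_def
      unfused_weight_eq_core sum_distrib_left sum_distrib_right mult_ac simp del: sum.atMost_Suc)

lemma gauge_mat_core_mat_commute:
  "mat_mul (gauge_mat (snd p) y y') (core_mat t z w \<gamma> \<theta> p) =
     mat_mul (core_mat t z w \<gamma> \<theta> p) (gauge_mat (snd p) y y')"
proof -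
  have "gauge (snd p) y a * gauge (snd p) y' b * (core_weight t z p a n a' k * core_weight t w p b k b' m) =
     core_weight t z p a n a' k * core_weight t w p b k b' m * (gauge (snd p) y a' * gauge (snd p) y' b')"
    for a b a' b' n k m
    using gauge_core_weight[of t p z a n a' k y] gauge_core_weight[of t p w b k b' m y']
    by (cases "core_weight t z p a n a' k = 0"; cases "core_weight t w p b k b' m = 0") simp_all
  then show ?thesis
    by (simp only: fun_eq_iff split_paired_All core_mat_def gauge_mat_def mat_mul_diag_left mat_mul_diag_right
      two_rows_def prod.case sum_distrib_left sum_distrib_right simp_thms)
qed

text \<open>Only the first vertex of the block, at the minimal color, has a gauge factor, and this
  commutes with the remaining core columns of the same dolor.\<close>

lemma block_mat:
  fixes \<gamma> \<theta> :: "'c::{finite,linorder} \<times> 'd::{finite,linorder} \<Rightarrow> nat"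
  shows "mat_prod (column_mat t z w \<gamma> \<theta>) (map (\<lambda>c. (c, d)) (sorted_list_of_set UNIV)) =
     mat_mul (mat_prod (core_mat t z w \<gamma> \<theta>) (map (\<lambda>c. (c, d)) (sorted_list_of_set UNIV))) (gauge_mat d z w)"
proof -
  let ?block = "\<lambda>cs. map (\<lambda>c :: 'c. (c, d)) cs" and ?C = "sorted_list_of_set (UNIV - {Min UNIV}) :: 'c list"
  have "mat_prod (column_mat t z w \<gamma> \<theta>) (?block ?C) = mat_prod (core_mat t z w \<gamma> \<theta>) (?block ?C)"
    by (rule mat_prod_cong) (auto simp: column_mat_eq_core)
  moreover have "mat_mul (gauge_mat d z w) (mat_prod (core_mat t z w \<gamma> \<theta>) (?block ?C)) =
      mat_mul (mat_prod (core_mat t z w \<gamma> \<theta>) (?block ?C)) (gauge_mat d z w)"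
    by (intro mat_prod_commute) (metis (no_types, lifting) gauge_mat_core_mat_commute image_iff list.set_map snd_conv)
  moreover have "sorted_list_of_set (UNIV :: 'c set) = Min UNIV # ?C"
    by (rule sorted_list_of_set_nonempty) simp_all
  ultimately show ?thesis
    by (simp add: column_mat_eq_core mat_mul_assoc)
qed

section \<open>Orders of the labels along the row, and the train argument\<close>

text \<open>\<open>Q\<close> is put below its complement, each part keeping its own order. For an
  upper set \<open>Q\<close> of a finite linear order this is a cyclic rotation.\<close>

definition rotated_less :: "'a::linorder set \<Rightarrow> 'a \<Rightarrow> 'a \<Rightarrow> bool" where
  "rotated_less Q x y \<longleftrightarrow> (if x \<in> Q \<longleftrightarrow> y \<in> Q then x < y else x \<in> Q)"

text \<open>
  The order inside the block of \<open>d\<close> when the dolors in \<open>Q\<close> and the colors in \<open>P\<close> have been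
  passed: remaining colors, then dolors other than \<open>d\<close>, then passed colors, then \<open>d\<close>.
\<close>

fun state_less :: "'d::linorder set \<Rightarrow> 'd \<Rightarrow> 'c::linorder set \<Rightarrow> 'c + 'd \<Rightarrow> 'c + 'd \<Rightarrow> bool" where
  "state_less Q d P (Color a) (Color b) \<longleftrightarrow> rotated_less (- P) a b"
| "state_less Q d P (Color a) (Dolor x) \<longleftrightarrow> x = d \<or> a \<notin> P"
| "state_less Q d P (Dolor x) (Color a) \<longleftrightarrow> x \<noteq> d \<and> a \<in> P"
| "state_less Q d P (Dolor x) (Dolor y) \<longleftrightarrow> rotated_less Q x y"

text \<open>With no color marked as passed, all colors lie below all dolors, whichever dolor is
  current. Hence the end of one block can be read as the beginning of the next.\<close>

lemma state_less_empty:
  fixes Q :: "'d::linorder set"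
  shows "(state_less Q d {} :: 'c::linorder + 'd \<Rightarrow> _) = state_less Q d' {}"
proof (intro ext)
  show "state_less Q d {} a b = state_less Q d' {} a b" for a b :: "'c + 'd"
    by (cases a; cases b) simp_all
qed

lemma state_less_empty_eq_edge_less:
  fixes Q :: "'d::linorder set"
  assumes "Q = {} \<or> Q = UNIV"
  shows "(state_less Q d {} :: 'c::linorder + 'd \<Rightarrow> _) = edge_less"
proof (intro ext)
  show "state_less Q d {} a b = edge_less a b" for a b :: "'c + 'd"
    using assms by (cases a; cases b) (auto simp: rotated_less_def)
qed

text \<open>By the hypotheses \<open>d\<close> is the largest dolor not yet passed and
  \<open>P\<close> consists of the colors below \<open>c\<close>. So \<open>c\<close> is lowest and
  \<open>d\<close> highest in the state order, and adding \<open>c\<close> to \<open>P\<close> lifts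
  it to just below \<open>d\<close>, as \<open>column_intertwines\<close> requires.\<close>

lemma core_mat_intertwines:
  assumes Q: "d \<notin> Q" "\<And>x. x \<notin> Q \<Longrightarrow> x \<le> d"
    and P: "c \<notin> P" "\<And>a. a \<in> P \<Longrightarrow> a < c" "\<And>a. a \<notin> P \<Longrightarrow> c \<le> a"
  shows "mat_mul (order_R t (swap_factor t) (state_less Q d P) z w) (core_mat t z w \<gamma> \<theta> (c, d)) =
    mat_mul (core_mat t w z \<gamma> \<theta> (c, d)) (order_R t (swap_factor t) (state_less Q d (insert c P)) z w)"
proof -
  have colors: "a < c \<longleftrightarrow> a \<in> P" "c < a \<longleftrightarrow> a \<noteq> c \<and> a \<notin> P" for a
    using P by force+
  have dolors: "x < d" "\<not> d < x" if "x \<noteq> d" "x \<notin> Q" for x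
    using that Q by force+
  show ?thesis
    unfolding core_mat_def fst_conv snd_conv
  proof (rule column_intertwines[OF column_data_swap_passing])
    show "state_less Q d P (Color c) a \<and> \<not> state_less Q d P a (Color c)" if "a \<noteq> Color c" for a
      using that P(1) colors by (cases a) (auto simp: rotated_less_def)
    show "state_less Q d P a (Dolor d) \<and> \<not> state_less Q d P (Dolor d) a \<and>
      state_less Q d (insert c P) a (Dolor d) \<and> \<not> state_less Q d (insert c P) (Dolor d) a"
      if "a \<noteq> Dolor d" for a
      using that Q(1) dolors by (cases a) (auto simp: rotated_less_def)
    show "state_less Q d (insert c P) a (Color c) \<and> \<not> state_less Q d (insert c P) (Color c) a"
      if "a \<noteq> Color c" "a \<noteq> Dolor d" for a
      using that P(1) colors by (cases a) (auto simp: rotated_less_def)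
    show "state_less Q d (insert c P) a b = state_less Q d P a b"
      if "a \<noteq> Color c" "b \<noteq> Color c" for a b
      using that by (cases a; cases b) (auto simp: rotated_less_def)
  qed
qed

lemma core_block_intertwines:
  assumes Q: "d \<notin> Q" "\<And>x. x \<notin> Q \<Longrightarrow> x \<le> d"
    and "sorted_wrt (<) cs" "\<And>a c. a \<in> P \<Longrightarrow> c \<in> set cs \<Longrightarrow> a < c" "P \<union> set cs = UNIV"
  shows "mat_mul (order_R t (swap_factor t) (state_less Q d P) z w)
      (mat_prod (core_mat t z w \<gamma> \<theta>) (map (\<lambda>c. (c, d)) cs)) =
    mat_mul (mat_prod (core_mat t w z \<gamma> \<theta>) (map (\<lambda>c. (c, d)) cs))
      (order_R t (swap_factor t) (state_less Q d UNIV) z w)"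
  using assms(3-)
proof (induction cs arbitrary: P)
  case (Cons c cs)
  have "c \<notin> P" "\<And>a. a \<in> P \<Longrightarrow> a < c"
    using Cons.prems by auto
  moreover have "c \<le> a" if "a \<notin> P" for a
    using Cons.prems that UNIV_I[of a]
    by (metis UnE insert_iff less_imp_le list.simps(15) order_refl sorted_wrt.simps(2))
  moreover have "mat_mul (order_R t (swap_factor t) (state_less Q d (insert c P)) z w)
      (mat_prod (core_mat t z w \<gamma> \<theta>) (map (\<lambda>c. (c, d)) cs)) =
    mat_mul (mat_prod (core_mat t w z \<gamma> \<theta>) (map (\<lambda>c. (c, d)) cs))
      (order_R t (swap_factor t) (state_less Q d UNIV) z w)"
    using Cons.prems by (intro Cons.IH) auto
  ultimately show ?case
    by (auto intro!: intertwine_mul core_mat_intertwines[OF Q])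
qed simp

text \<open>Swap entries meet the same gauge product on both sides. In a diagonal entry where
  exactly one label is a dolor other than \<open>d\<close>, the gauge gives z on one side and w on
  the other, which reversing the order of the two labels compensates. In the remaining cases the
  gauge products agree and the order is kept.\<close>

lemma gauge_mat_intertwines:
  fixes Q :: "'d::{finite,linorder} set" and z w :: complex
  assumes Q: "d \<notin> Q" "\<And>x. x \<notin> Q \<Longrightarrow> x \<le> d"  "\<And>x. x \<in> Q \<Longrightarrow> d < x"
  shows "mat_mul (order_R t (swap_factor t) (state_less Q d (UNIV :: 'c::{finite,linorder} set)) z w)
      (gauge_mat d z w) =
    mat_mul (gauge_mat d w z) (order_R t (swap_factor t) (state_less (insert d Q) d {}) z w)"
proof -
  have lt: "x < d \<longleftrightarrow> x \<noteq> d \<and> x \<notin> Q" "d < x \<longleftrightarrow> x \<in> Q" for x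
    using Q by (force, force)
  have "(if state_less Q d UNIV b a then z else w) * (gauge d z a * gauge d w b) =
    gauge d w a * gauge d z b * (if state_less (insert d Q) d {} b a then z else w)"
    if "a \<noteq> b" for a b :: "'c + 'd"
    using that lt Q(1) by (cases a; cases b) (auto simp: gauge_def rotated_less_def)
  then have "order_R t (swap_factor t) (state_less Q d UNIV) z w (a, b) (a', b') * (gauge d z a' * gauge d w b') =
    gauge d w a * gauge d z b * order_R t (swap_factor t) (state_less (insert d Q) d {}) z w (a, b) (a', b')"
    for a b a' b' :: "'c + 'd"
    by (simp add: order_R_def mult_ac)
  then show ?thesis
    by (simp add: fun_eq_iff gauge_mat_def mat_mul_diag_left mat_mul_diag_right)
qed

text \<open>The gauge at the end of the block of \<open>d\<close> turns \<open>Q\<close> into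
  \<open>insert d Q\<close> and resets the passed colors, so the blocks chain by induction. By
  \<open>state_less_empty\<close> the dolor \<open>e\<close> is a dummy.\<close>

lemma dolor_blocks_intertwine:
  fixes \<gamma> \<theta> :: "'c::{finite,linorder} \<times> 'd::{finite,linorder} \<Rightarrow> nat"
  assumes "sorted_wrt (>) ds" "\<And>x d. x \<in> Q \<Longrightarrow> d \<in> set ds \<Longrightarrow> d < x" "Q \<union> set ds = UNIV"
  shows "mat_mul (order_R t (swap_factor t) (state_less Q e {}) z w)
      (mat_prod (column_mat t z w \<gamma> \<theta>)
        (concat (map (\<lambda>d. map (\<lambda>c. (c, d)) (sorted_list_of_set UNIV)) ds))) =
    mat_mul (mat_prod (column_mat t w z \<gamma> \<theta>)
        (concat (map (\<lambda>d. map (\<lambda>c. (c, d)) (sorted_list_of_set UNIV)) ds)))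
      (order_R t (swap_factor t) (state_less UNIV e {}) z w)"
  using assms
proof (induction ds arbitrary: Q)
  case (Cons d ds)
  have Q: "d \<notin> Q" "\<And>x. x \<in> Q \<Longrightarrow> d < x"
    using Cons.prems by auto
  have Q': "x \<le> d" if "x \<notin> Q" for x
    using Cons.prems that UNIV_I[of x]
    by (metis UnE insert_iff less_imp_le list.simps(15) order_refl sorted_wrt.simps(2))
  have e: "(state_less Q' e {} :: 'c + 'd \<Rightarrow> _) = state_less Q' d {}" for Q'
    by (rule state_less_empty)
  let ?block = "map (\<lambda>c. (c, d)) (sorted_list_of_set UNIV)"
  have "mat_mul (order_R t (swap_factor t) (state_less Q e {}) z w)
      (mat_prod (core_mat t z w \<gamma> \<theta>) ?block) =
    mat_mul (mat_prod (core_mat t w z \<gamma> \<theta>) ?block)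
      (order_R t (swap_factor t) (state_less Q d UNIV) z w)"
    using core_block_intertwines[OF Q(1) Q', of "sorted_list_of_set (UNIV :: 'c set)" "{}"]
    by (simp add: e)
  from intertwine_mul[OF this gauge_mat_intertwines[OF Q(1) Q' Q(2)]]
  have "mat_mul (order_R t (swap_factor t) (state_less Q e {}) z w)
      (mat_prod (column_mat t z w \<gamma> \<theta>) ?block) =
    mat_mul (mat_prod (column_mat t w z \<gamma> \<theta>) ?block)
      (order_R t (swap_factor t) (state_less (insert d Q) e {}) z w)"
    by (simp add: block_mat e)
  moreover have "mat_mul (order_R t (swap_factor t) (state_less (insert d Q) e {}) z w)
      (mat_prod (column_mat t z w \<gamma> \<theta>)
        (concat (map (\<lambda>d. map (\<lambda>c. (c, d)) (sorted_list_of_set UNIV)) ds))) =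
    mat_mul (mat_prod (column_mat t w z \<gamma> \<theta>)
        (concat (map (\<lambda>d. map (\<lambda>c. (c, d)) (sorted_list_of_set UNIV)) ds)))
      (order_R t (swap_factor t) (state_less UNIV e {}) z w)"
    using Cons.prems by (intro Cons.IH) auto
  ultimately show ?case
    by (simp add: mat_prod_append intertwine_mul)
qed simp

lemma pairs_intertwine:
  fixes \<gamma> \<theta> :: "'c::{finite,linorder} \<times> 'd::{finite,linorder} \<Rightarrow> nat"
  shows "mat_mul (order_R t (swap_factor t) edge_less z w) (mat_prod (column_mat t z w \<gamma> \<theta>) pairs) =
    mat_mul (mat_prod (column_mat t w z \<gamma> \<theta>) pairs) (order_R t (swap_factor t) edge_less z w)"
  \<comment> \<open>\<open>Q\<close> runs from the empty set to \<open>UNIV\<close>, and both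
    extremes give \<open>edge_less\<close>; \<open>undefined\<close> fills the place of the dummy
    dolor.\<close>
  using dolor_blocks_intertwine[of "rev (sorted_list_of_set UNIV)" "{}" t undefined z w \<gamma> \<theta>]
  by (simp add: pairs_def sorted_wrt_rev state_less_empty_eq_edge_less)

section \<open>Fused weights as sums over paths\<close>

text \<open>Summing over every internal labelling, admissible or not, instead of selecting one,
  gives the weight the form of an iterated matrix product.\<close>

fun path_weight ::
  "('p \<Rightarrow> 'e::finite \<Rightarrow> nat \<Rightarrow> 'e \<Rightarrow> nat \<Rightarrow> complex) \<Rightarrow>
   'p list \<Rightarrow> 'e \<Rightarrow> ('p \<Rightarrow> nat) \<Rightarrow> 'e \<Rightarrow> ('p \<Rightarrow> nat) \<Rightarrow> complex" where
  "path_weight T [] l N r M = (if l = r then 1 else 0)"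
| "path_weight T (p # ps) l N r M = (\<Sum>x\<in>UNIV. T p l (N p) x (M p) * path_weight T ps x N r M)"

lemma path_weight_upd:
  "p \<notin> set ps \<Longrightarrow> path_weight T ps l (N(p := k)) r M = path_weight T ps l N r M"
  "p \<notin> set ps \<Longrightarrow> path_weight T ps l N r (M(p := k)) = path_weight T ps l N r M"
  by (induction ps arbitrary: l) auto

text \<open>As the columns are distinct, each \<open>\<kappa> p\<close> enters the column of
  \<open>p\<close> alone, so the sum over \<kappa> factors column by column.\<close>

lemma sum_path_weights:
  assumes "distinct ps"
  shows "(\<Sum>\<kappa>\<in>PiE (set ps) (\<lambda>p. {..Suc (\<gamma> p)}). path_weight T ps x \<gamma> x' \<kappa> * path_weight T' ps y \<kappa> y' \<theta>) =
    mat_prod (\<lambda>p. two_rows (T p) (T' p) (\<gamma> p) (\<theta> p)) ps (x, y) (x', y')"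
  using assms
proof (induction ps arbitrary: x y)
  case Nil
  then show ?case by (auto simp: mat_diag_def PiE_empty_domain)
next
  case (Cons p ps)
  then have p: "p \<notin> set ps" by simp
  let ?K = "PiE (set ps) (\<lambda>p. {..Suc (\<gamma> p)})"
  have inj: "inj_on (\<lambda>(k, \<kappa>). \<kappa>(p := k)) ({..Suc (\<gamma> p)} \<times> ?K)"
    by (rule inj_combinator[OF p])
  have "(\<Sum>\<kappa>\<in>PiE (set (p # ps)) (\<lambda>p. {..Suc (\<gamma> p)}). path_weight T (p # ps) x \<gamma> x' \<kappa> *
      path_weight T' (p # ps) y \<kappa> y' \<theta>) =
    (\<Sum>(k, \<kappa>)\<in>{..Suc (\<gamma> p)} \<times> ?K. path_weight T (p # ps) x \<gamma> x' (\<kappa>(p := k)) *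
      path_weight T' (p # ps) y (\<kappa>(p := k)) y' \<theta>)"
    unfolding list.set PiE_insert_eq sum.reindex[OF inj] by (simp only: comp_def case_prod_unfold)
  also have "\<dots> = (\<Sum>(k, \<kappa>)\<in>{..Suc (\<gamma> p)} \<times> ?K. \<Sum>(u, v)\<in>UNIV.
      (T p x (\<gamma> p) u k * T' p y k v (\<theta> p)) * (path_weight T ps u \<gamma> x' \<kappa> * path_weight T' ps v \<kappa> y' \<theta>))"
  proof (intro sum.cong refl, clarify)
    fix k \<kappa>
    have "(\<Sum>u\<in>UNIV. f u) * (\<Sum>v\<in>UNIV. g v) = (\<Sum>(u, v)\<in>UNIV. f u * g v)" for f g :: "'b \<Rightarrow> complex"
      by (simp only: sum_product sum.cartesian_product UNIV_Times_UNIV)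
    then show "path_weight T (p # ps) x \<gamma> x' (\<kappa>(p := k)) * path_weight T' (p # ps) y (\<kappa>(p := k)) y' \<theta> =
      (\<Sum>(u, v)\<in>UNIV. (T p x (\<gamma> p) u k * T' p y k v (\<theta> p)) *
        (path_weight T ps u \<gamma> x' \<kappa> * path_weight T' ps v \<kappa> y' \<theta>))"
      by (simp only: path_weight.simps path_weight_upd[OF p] fun_upd_same mult_ac)
  qed
  also have "\<dots> = (\<Sum>(u, v)\<in>UNIV. \<Sum>(k, \<kappa>)\<in>{..Suc (\<gamma> p)} \<times> ?K.
      (T p x (\<gamma> p) u k * T' p y k v (\<theta> p)) * (path_weight T ps u \<gamma> x' \<kappa> * path_weight T' ps v \<kappa> y' \<theta>))"
    unfolding case_prod_unfold by (rule sum.swap)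
  also have "\<dots> = (\<Sum>(u, v)\<in>UNIV. two_rows (T p) (T' p) (\<gamma> p) (\<theta> p) (x, y) (u, v) *
      (\<Sum>\<kappa>\<in>?K. path_weight T ps u \<gamma> x' \<kappa> * path_weight T' ps v \<kappa> y' \<theta>))"
    by (intro sum.cong refl, clarify) (simp only: two_rows_def prod.case sum_product sum.cartesian_product)
  also have "\<dots> = mat_prod (\<lambda>p. two_rows (T p) (T' p) (\<gamma> p) (\<theta> p)) (p # ps) (x, y) (x', y')"
    unfolding mat_prod_simps mat_mul_def
    using Cons by (intro sum.cong refl, clarify) (simp only: distinct.simps simp_thms)
  finally show ?case .
qed

lemma unfused_weight_admissible:
  "unfused_weight t z p l n r m \<noteq> 0 \<Longrightarrow> unfused_admissible p l n r m"
  by (auto simp: unfused_weight_eq_core column_weight_def unfused_admissible_def split: if_splits)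

text \<open>The left, top and bottom edges determine an admissible right edge, so all paths other
  than \<open>h\<close> contribute zero.\<close>

lemma path_weight_labelling:
  assumes "length h = length ps + 1" "hd h = l" "last h = r"
    "\<forall>i<length ps. unfused_admissible (ps ! i) (h ! i) (N (ps ! i)) (h ! Suc i) (M (ps ! i))"
  shows "path_weight (unfused_weight t z) ps l N r M =
    (\<Prod>i<length ps. unfused_weight t z (ps ! i) (h ! i) (N (ps ! i)) (h ! Suc i) (M (ps ! i)))"
  using assms
proof (induction ps arbitrary: l h)
  case Nil
  then show ?case by (cases h) auto
next
  case (Cons p ps)
  then obtain h' where h': "h = l # h'" "length h' = length ps + 1"
    by (cases h) auto
  then have "h' \<noteq> []"
    by auto
  note h = h'(1) this h'(2)
  have adm: "unfused_admissible p l (N p) (hd h') (M p)"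
    using Cons.prems(4) h by (auto simp: hd_conv_nth)
  have "path_weight (unfused_weight t z) (p # ps) l N r M =
    (\<Sum>x\<in>{hd h'}. unfused_weight t z p l (N p) x (M p) *
      path_weight (unfused_weight t z) ps x N r M)"
    unfolding path_weight.simps
    by (rule sum.mono_neutral_right)
      (auto dest: unfused_weight_admissible unfused_admissible_unique[OF adm])
  also have "\<dots> = unfused_weight t z p l (N p) (hd h') (M p) * path_weight (unfused_weight t z) ps (hd h') N r M"
    by simp
  also have "path_weight (unfused_weight t z) ps (hd h') N r M =
    (\<Prod>i<length ps. unfused_weight t z (ps ! i) (h' ! i) (N (ps ! i)) (h' ! Suc i) (M (ps ! i)))"
    using Cons.prems h by (intro Cons.IH) auto
  finally show ?case
    using h by (simp add: prod.lessThan_Suc_shift hd_conv_nth del: prod.lessThan_Suc)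
qed

lemma path_weight_labelling_exists:
  assumes "path_weight (unfused_weight t z) ps l N r M \<noteq> 0"
  shows "\<exists>h. length h = length ps + 1 \<and> hd h = l \<and> last h = r \<and>
    (\<forall>i<length ps. unfused_admissible (ps ! i) (h ! i) (N (ps ! i)) (h ! Suc i) (M (ps ! i)))"
  using assms
proof (induction ps arbitrary: l)
  case Nil
  then show ?case by (intro exI[of _ "[l]"]) (simp split: if_splits)
next
  case (Cons p ps)
  then have "(\<Sum>x\<in>UNIV. unfused_weight t z p l (N p) x (M p) *
      path_weight (unfused_weight t z) ps x N r M) \<noteq> 0"
    by simp
  then obtain x where "unfused_weight t z p l (N p) x (M p) *
      path_weight (unfused_weight t z) ps x N r M \<noteq> 0"
    by (rule sum.not_neutral_contains_not_neutral)
  then have x: "unfused_weight t z p l (N p) x (M p) \<noteq> 0" "path_weight (unfused_weight t z) ps x N r M \<noteq> 0"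
    by simp_all
  from Cons.IH[OF x(2)] obtain h where h: "length h = length ps + 1" "hd h = x" "last h = r"
    "\<forall>i<length ps. unfused_admissible (ps ! i) (h ! i) (N (ps ! i)) (h ! Suc i) (M (ps ! i))" by blast
  moreover have "h \<noteq> []"
    using h(1) by auto
  moreover from this have "h ! 0 = x"
    using h(2) by (simp add: hd_conv_nth)
  ultimately show ?case
    using unfused_weight_admissible[OF x(1)]
    by (intro exI[of _ "l # h"]) (auto simp: All_less_Suc2)
qed

lemma fused_weight_eq_path_weight:
  "fused_weight t z l N r M = path_weight (unfused_weight t z) pairs l N r M"
proof (cases "\<exists>h. fused_labelling l N r M h")
  case True
  then obtain h where h: "fused_labelling l N r M h" by blast
  then have "\<exists>!h. fused_labelling l N r M h" "(THE h. fused_labelling l N r M h) = h"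
    using fused_labelling_unique by blast+
  moreover have "path_weight (unfused_weight t z) pairs l N r M =
      (\<Prod>i<length (pairs :: ('a \<times> 'b) list).
        unfused_weight t z (pairs ! i) (h ! i) (N (pairs ! i)) (h ! Suc i) (M (pairs ! i)))"
    using h unfolding fused_labelling_def by (intro path_weight_labelling) auto
  ultimately show ?thesis
    by (simp add: fused_weight_def)
next
  case False
  then have "\<not> (\<exists>!h. fused_labelling l N r M h)" by blast
  then show ?thesis
    using False path_weight_labelling_exists[of t z pairs l N r M]
    by (auto simp: fused_weight_def fused_labelling_def)
qed

section \<open>Sums over the middle edges and the conclusion\<close>

lemma path_weight_unfused_bound:
  assumes "path_weight (unfused_weight t z) ps l N r M \<noteq> 0" and "p \<in> set ps"
  shows "M p \<le> Suc (N p)"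
proof -
  from path_weight_labelling_exists[OF assms(1)] assms(2) obtain l' r'
    where "unfused_admissible p l' (N p) r' (M p)"
    by (metis in_set_conv_nth)
  then show ?thesis
    by (auto simp: unfused_admissible_def)
qed

lemma distinct_if_sorted_pair_less: "sorted_wrt pair_less ps \<Longrightarrow> distinct ps"
  by (induction ps) (auto simp: pair_less_def)

lemma sum_fused_weights:
  fixes \<gamma> \<theta> :: "'c::{finite,linorder} \<times> 'd::{finite,linorder} \<Rightarrow> nat"
  shows "(\<Sum>\<kappa>\<in>PiE UNIV (\<lambda>p. {..Suc (\<gamma> p)}). fused_weight t z x \<gamma> x' \<kappa> * fused_weight t w y \<kappa> y' \<theta>) =
    mat_prod (column_mat t z w \<gamma> \<theta>) pairs (x, y) (x', y')"
proof -
  have "distinct (pairs :: ('c \<times> 'd) list)"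
    using sorted_pairs by (rule distinct_if_sorted_pair_less)
  from sum_path_weights[OF this, of "unfused_weight t z" x \<gamma> x' "unfused_weight t w" y y' \<theta>]
  show ?thesis
    by (simp add: set_pairs fused_weight_eq_path_weight column_mat_def[abs_def])
qed

theorem theorem4p1:
  fixes t z w :: complex
    and \<alpha> \<beta> \<delta> \<rho> :: "'c::{finite,linorder} + 'd::{finite,linorder}"
    and \<gamma> \<theta> :: "'c \<times> 'd \<Rightarrow> nat"
  shows
    "finite {(x, y, \<kappa>). R_weight t z w \<alpha> \<beta> x y * fused_weight t z x \<gamma> \<delta> \<kappa> * fused_weight t w y \<kappa> \<rho> \<theta> \<noteq> 0} \<and>
     finite {(x, y, \<kappa>). fused_weight t w \<alpha> \<gamma> x \<kappa> * fused_weight t z \<beta> \<kappa> y \<theta> * R_weight t z w x y \<delta> \<rho> \<noteq> 0} \<and>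
     Sum_any (\<lambda>(x, y, \<kappa>). R_weight t z w \<alpha> \<beta> x y * fused_weight t z x \<gamma> \<delta> \<kappa> * fused_weight t w y \<kappa> \<rho> \<theta>) =
     Sum_any (\<lambda>(x, y, \<kappa>). fused_weight t w \<alpha> \<gamma> x \<kappa> * fused_weight t z \<beta> \<kappa> y \<theta> * R_weight t z w x y \<delta> \<rho>)"
proof -
  \<comment> \<open>In both sums the upper row has \<gamma> on top and \<kappa> below, so this
    finite box contains every \<kappa> of a nonzero term.\<close>
  define K where "K = PiE (UNIV :: ('c \<times> 'd) set) (\<lambda>p. {..Suc (\<gamma> p)})"
  let ?S = "(UNIV :: ('c + 'd) set) \<times> (UNIV :: ('c + 'd) set) \<times> K"
  let ?f = "\<lambda>(x, y, \<kappa>). R_weight t z w \<alpha> \<beta> x y * fused_weight t z x \<gamma> \<delta> \<kappa> * fused_weight t w y \<kappa> \<rho> \<theta>"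
  let ?g = "\<lambda>(x, y, \<kappa>). fused_weight t w \<alpha> \<gamma> x \<kappa> * fused_weight t z \<beta> \<kappa> y \<theta> * R_weight t z w x y \<delta> \<rho>"
  let ?R = "order_R t (swap_factor t) edge_less z w :: ('c + 'd) \<times> ('c + 'd) \<Rightarrow> _"
  have fin: "finite ?S"
    unfolding K_def by (intro finite_cartesian_product finite_PiE) simp_all
  have K: "\<kappa> \<in> K" if "fused_weight t y l \<gamma> r \<kappa> \<noteq> 0" for y l r \<kappa>
    using path_weight_unfused_bound[of t y pairs l \<gamma> r \<kappa>] that
    by (simp add: K_def PiE_UNIV_domain fused_weight_eq_path_weight set_pairs)
  have f: "{q. ?f q \<noteq> 0} \<subseteq> ?S" and g: "{q. ?g q \<noteq> 0} \<subseteq> ?S"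
    using K by auto
  have "Sum_any ?f = (\<Sum>x\<in>UNIV. \<Sum>y\<in>UNIV. \<Sum>\<kappa>\<in>K. ?f (x, y, \<kappa>))"
    unfolding Sum_any.expand_superset[OF fin f] sum.cartesian_product by simp
  also have "\<dots> = mat_mul ?R (mat_prod (column_mat t z w \<gamma> \<theta>) pairs) (\<alpha>, \<beta>) (\<delta>, \<rho>)"
    unfolding mat_mul_def UNIV_Times_UNIV[symmetric] sum.cartesian_product'
    by (simp add: R_weight_eq_order_R sum_fused_weights[symmetric] K_def sum_distrib_left mult.assoc)
  also have "\<dots> = mat_mul (mat_prod (column_mat t w z \<gamma> \<theta>) pairs) ?R (\<alpha>, \<beta>) (\<delta>, \<rho>)"
    by (simp add: pairs_intertwine)
  also have "\<dots> = (\<Sum>x\<in>UNIV. \<Sum>y\<in>UNIV. \<Sum>\<kappa>\<in>K. ?g (x, y, \<kappa>))"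
    unfolding mat_mul_def UNIV_Times_UNIV[symmetric] sum.cartesian_product'
    by (simp add: R_weight_eq_order_R sum_fused_weights[symmetric] K_def sum_distrib_right)
  also have "\<dots> = Sum_any ?g"
    unfolding Sum_any.expand_superset[OF fin g] sum.cartesian_product by simp
  finally have "Sum_any ?f = Sum_any ?g" .
  moreover have "finite {q. ?f q \<noteq> 0}" "finite {q. ?g q \<noteq> 0}"
    using f g fin by (auto intro: finite_subset)
  ultimately show ?thesis
    by (simp add: case_prod_unfold)
qed

end
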